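(* Let $V$ be a Banach space and let $T:V\to V$ be a firmly nonexpansive map with $\tau=0$, where $\tau=\lim_{n\to\infty}\frac{1}{n}\|T^nx\|$. Then there is a metric functional $h$ on $V$ which is a limit point of the orbit $(T^{n}0)_{n\geq 0}$ in the compact space $\overline{\Phi(V)}$ and such that $$h(Tx)\leq h(x)\quad\text{for all } x\in V.$$
   Context: A map $T:V\to V$ of a Banach space is firmly nonexpansive if $$\|Tx-Ty\|\leq\|(1-t)(Tx-Ty)+t(x-y)\|$$ for every $x,y\in V$ and every $t\geq 0$. In particular (take $t=1$) $T$ is nonexpansive, $\|Tx-Ty\|\le\|x-y\|$. For a nonexpansive map $T$ of $V$ into itself the limit $\tau=\lim_{n\to\infty}\frac1n\|T^nx\|$ exists and is independent of $x\in V$; $T^n$ denotes the $n$-th iterate. Metric functionals: for $x\in V$ let $h_x:V\to\mathbb{R}$, $h_x(y)=\|y-x\|-\|x\|$ (base point $0$), and let $\Phi:V\to\mathbb{R}^V$, $\Phi(x)=h_x$. Equip $\mathbb{R}^V$ with the topology of pointwise convergence. The closure $\overline{\Phi(V)}$ in $\mathbb{R}^V$ is compact, and its elements are called metric functionals on $V$. The space $V$ is identified with its image under the injective continuous map $\Phi$; thus "$h$ is a limit point of $(T^n0)_{n\ge0}$ in $\overline{\Phi(V)}$" means that $h$ is a cluster point of the sequence $(h_{T^n0})_{n\geq 0}$: every neighbourhood of $h$ in $\overline{\Phi(V)}$ contains $h_{T^n0}$ for infinitely many $n$. *)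

theory Defs
  imports "HOL-Analysis.Analysis"
begin

definition firmly_nonexpansive :: "('a::real_normed_vector \<Rightarrow> 'a) \<Rightarrow> bool" where
  "firmly_nonexpansive T \<longleftrightarrow>
     (\<forall>x y. \<forall>t\<ge>0::real. norm (T x - T y) \<le> norm ((1 - t) *\<^sub>R (T x - T y) + t *\<^sub>R (x - y)))"

lemma firmly_nonexpansive_imp_nonexpansive:
  assumes "firmly_nonexpansive T"
  shows "norm (T x - T y) \<le> norm (x - y)"
  using assms[unfolded firmly_nonexpansive_def, rule_format, of 1 x y] by simp

text \<open>
  The base point of the orbit is fixed to be 0; for nonexpansive maps the limit exists and does not
  depend on this choice (lemma \<open>tendsto_escape_rate\<close> below).
\<close>

definition escape_rate :: "('a::real_normed_vector \<Rightarrow> 'a) \<Rightarrow> real" where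
  "escape_rate T = lim (\<lambda>n. norm ((T ^^ n) 0) / real n)"

lemma funpow_nonexpansive:
  fixes T :: "'a::real_normed_vector \<Rightarrow> 'a"
  assumes "\<And>x y. norm (T x - T y) \<le> norm (x - y)"
  shows "norm ((T ^^ n) x - (T ^^ n) y) \<le> norm (x - y)"
proof (induction n)
  case (Suc n)
  have "norm ((T ^^ Suc n) x - (T ^^ Suc n) y) \<le> norm ((T ^^ n) x - (T ^^ n) y)"
    using assms by simp
  with Suc show ?case by linarith
qed simp

lemma subadditive_convergent:
  fixes a :: "nat \<Rightarrow> real"
  assumes nonneg: "\<And>n. 0 \<le> a n" and sub: "\<And>m n. a (m + n) \<le> a m + a n"
  shows "convergent (\<lambda>n. a n / real n)"
proof -
  define L where "L = (INF n\<in>{1..}. a n / real n)"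
  have bdd: "bdd_below ((\<lambda>n. a n / real n) ` {1..})"
    using nonneg by (intro bdd_belowI[of _ 0]) auto
  have lower: "L \<le> a n / real n" if "n \<ge> 1" for n
    unfolding L_def using bdd that by (intro cINF_lower) auto
  have mult: "a (q * m) \<le> real q * a m" if "q \<ge> 1" for q m
    using that
  proof (induction q rule: nat_induct_at_least)
    case (Suc q)
    then show ?case using sub[of m "q * m"] by (simp add: algebra_simps)
  qed simp
  have lin: "a n \<le> a 0 + real n * a 1" for n
    using mult[of n 1] nonneg[of 0] nonneg[of 1] by (cases "n = 0") auto
  have "(\<lambda>n. a n / real n) \<longlonglongrightarrow> L"
  proof (rule LIMSEQ_I)
    fix e :: real assume "e > 0"
    obtain m where m: "m \<ge> 1" "a m / real m < L + e / 2"
    proof -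
      have "\<exists>m\<in>{1..}. a m / real m < L + e / 2"
        using \<open>e > 0\<close> bdd unfolding L_def
        by (subst cINF_less_iff[symmetric]) auto
      then show ?thesis using that by auto
    qed
    define C where "C = a 0 + real m * a 1"
    have C: "C \<ge> 0" using nonneg by (simp add: C_def)
    obtain N :: nat where N: "real N > 2 * C / e" using reals_Archimedean2 by blast
    show "\<exists>no. \<forall>n\<ge>no. norm (a n / real n - L) < e"
    proof (intro exI[of _ "max N m"] allI impI)
      fix n assume n: "n \<ge> max N m"
      with m(1) have npos: "n \<ge> 1" by simp
      have q: "n div m \<ge> 1" using n m(1) by (simp add: div_greater_zero_iff Suc_le_eq)
      have "a n = a (n div m * m + n mod m)" by simp
      also have "\<dots> \<le> a (n div m * m) + a (n mod m)" by (rule sub)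
      also have "\<dots> \<le> real (n div m) * a m + (a 0 + real (n mod m) * a 1)"
        using mult[OF q] lin by (intro add_mono) auto
      also have "\<dots> \<le> real (n div m) * a m + C"
      proof -
        have "real (n mod m) * a 1 \<le> real m * a 1"
          using m(1) nonneg[of 1] by (intro mult_right_mono) (auto intro: less_imp_le)
        then show ?thesis by (simp add: C_def)
      qed
      also have "real (n div m) * a m \<le> (real n / real m) * a m"
        using nonneg by (intro mult_right_mono of_nat_div_le_of_nat) auto
      finally have "a n \<le> real n * (a m / real m) + C" by simp
      then have "a n / real n \<le> a m / real m + C / real n"
        using npos by (simp add: field_simps)
      moreover have "C / real n < e / 2"
      proof -
        have "real n > 2 * C / e" using N n by linarith
        then show ?thesis using npos \<open>e > 0\<close> by (simp add: field_simps)
      qed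
      ultimately have "a n / real n < L + e" using m(2) by linarith
      then show "norm (a n / real n - L) < e"
        using lower[OF npos] by simp
    qed
  qed
  then show ?thesis by (rule convergentI)
qed

lemma tendsto_escape_rate:
  fixes T :: "'a::real_normed_vector \<Rightarrow> 'a"
  assumes T: "\<And>x y. norm (T x - T y) \<le> norm (x - y)"
  shows "(\<lambda>n. norm ((T ^^ n) x) / real n) \<longlonglongrightarrow> escape_rate T"
proof -
  define a where "a n = norm ((T ^^ n) 0)" for n
  have "a (m + n) \<le> a m + a n" for m n
  proof -
    have "(T ^^ (m + n)) 0 = ((T ^^ m) ((T ^^ n) 0) - (T ^^ m) 0) + (T ^^ m) 0"
      by (simp add: funpow_add)
    then have "a (m + n) \<le> norm ((T ^^ m) ((T ^^ n) 0) - (T ^^ m) 0) + a m"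
      unfolding a_def by (metis norm_triangle_ineq)
    also have "\<dots> \<le> a n + a m"
      using funpow_nonexpansive[OF T, of m "(T ^^ n) 0" 0] by (simp add: a_def)
    finally show ?thesis by simp
  qed
  then have "convergent (\<lambda>n. a n / real n)"
    by (intro subadditive_convergent) (auto simp: a_def)
  then have 0: "(\<lambda>n. a n / real n) \<longlonglongrightarrow> escape_rate T"
    by (simp add: a_def escape_rate_def convergent_LIMSEQ_iff)
  have "(\<lambda>n. norm ((T ^^ n) x) / real n - a n / real n) \<longlonglongrightarrow> 0"
  proof (rule Lim_null_comparison)
    have "norm (norm ((T ^^ n) x) / real n - a n / real n) \<le> norm x / real n" for n
    proof -
      have "\<bar>norm ((T ^^ n) x) - a n\<bar> \<le> norm ((T ^^ n) x - (T ^^ n) 0)"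
        unfolding a_def by (rule norm_triangle_ineq3)
      also have "\<dots> \<le> norm x" using funpow_nonexpansive[OF T, of n x 0] by simp
      finally show ?thesis
        by (simp add: diff_divide_distrib[symmetric] abs_divide divide_right_mono)
    qed
    then show "\<forall>\<^sub>F n in sequentially.
        norm (norm ((T ^^ n) x) / real n - a n / real n) \<le> norm x / real n" by simp
    show "(\<lambda>n. norm x / real n) \<longlonglongrightarrow> 0" by (rule lim_const_over_n)
  qed
  from tendsto_add[OF this 0] show ?thesis by simp
qed

definition metric_embedding :: "'a::real_normed_vector \<Rightarrow> ('a \<Rightarrow> real)" where
  "metric_embedding x = (\<lambda>y. norm (y - x) - norm x)"

text \<open>
  The closure is taken in the type \<open>'a \<Rightarrow> real\<close>, whose topology in the library is the product
  topology, that is, the topology of pointwise convergence.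
\<close>

definition metric_functionals :: "('a::real_normed_vector \<Rightarrow> real) set" where
  "metric_functionals = closure (range metric_embedding)"

text \<open>
  This is a limit point of the sequence, not of its set of values: a value that is attained
  infinitely often counts.
\<close>

definition sequence_limit_point :: "'b topology \<Rightarrow> (nat \<Rightarrow> 'b) \<Rightarrow> 'b \<Rightarrow> bool" where
  "sequence_limit_point X u l \<longleftrightarrow>
     l \<in> topspace X \<and> (\<forall>U. openin X U \<and> l \<in> U \<longrightarrow> infinite {n. u n \<in> U})"

end

theory Submission
  imports Defs
begin

text \<open>
  The consecutive distances \<open>norm (T\<^sup>n\<^sup>+\<^sup>1 0 - T\<^sup>n 0)\<close> tend to zero, and this forces
  \<open>h (T x) \<le> h x\<close> for every cluster point \<open>h\<close> of the orbit. Indeed, since \<open>T\<close> is nonexpansive, replacing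
  \<open>x\<close> by \<open>T x\<close> increases the distance to \<open>T\<^sup>n 0\<close> by at most the length of the \<open>n\<close>th step
  (lemma \<open>metric_embedding_image_le\<close>), an error that disappears in the limit. Cluster points exist
  because the metric functionals form a compact set.

  The steps are controlled by the limits \<open>d k\<close> of \<open>norm (T\<^sup>n\<^sup>+\<^sup>k 0 - T\<^sup>n 0)\<close> as \<open>n\<close> grows.
  Firm nonexpansiveness at the midpoint parameter \<open>t = 1/2\<close> makes \<open>d\<close> a convex sequence with
  \<open>d 0 = 0\<close>, so \<open>k * d 1 \<le> d k\<close>. But \<open>d k \<le> norm (T\<^sup>k 0)\<close>, which is \<open>o(k)\<close> when the escape rate
  vanishes, and hence \<open>d 1 = 0\<close>.
\<close>

section \<open>Asymptotic regularity of firmly nonexpansive maps\<close>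

lemma firmly_nonexpansive_midpoint:
  assumes "firmly_nonexpansive T"
  shows "2 * norm (T x - T y) \<le> norm (T x - y) + norm (x - T y)"
proof -
  have "norm (T x - T y) \<le> norm ((1 - 1/2) *\<^sub>R (T x - T y) + (1/2) *\<^sub>R (x - y))"
    using assms unfolding firmly_nonexpansive_def by (metis zero_le_divide_1_iff zero_le_numeral)
  also have "(1 - 1/2) *\<^sub>R (T x - T y) + (1/2) *\<^sub>R (x - y) = (1/2) *\<^sub>R ((T x - y) + (x - T y))"
    by (simp add: algebra_simps)
  also have "norm \<dots> = norm ((T x - y) + (x - T y)) / 2"
    by simp
  also have "\<dots> \<le> (norm (T x - y) + norm (x - T y)) / 2"
    by (intro divide_right_mono norm_triangle_ineq) simp
  finally show ?thesis by simp
qed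

text \<open>
  The increments of a convex sequence are at least the first one, and they sum to the sequence.
\<close>

lemma convex_sequence_ge_linear:
  fixes d :: "nat \<Rightarrow> real"
  assumes "d 0 = 0" and convex: "\<And>k. 2 * d (Suc k) \<le> d (Suc (Suc k)) + d k"
  shows "real k * d 1 \<le> d k"
proof -
  have increment: "d 1 \<le> d (Suc k) - d k" for k
  proof (induction k)
    case (Suc k)
    then show ?case using convex[of k] by linarith
  qed (simp add: assms(1))
  show ?thesis
  proof (induction k)
    case (Suc k)
    then show ?case using increment[of k] by (simp add: algebra_simps)
  qed (simp add: assms(1))
qed

lemma nonexpansive_gap_convergent:
  fixes T :: "'a::real_normed_vector \<Rightarrow> 'a"
  assumes T: "\<And>x y. norm (T x - T y) \<le> norm (x - y)"
  obtains d where "\<And>k. (\<lambda>n. norm ((T ^^ (n + k)) x - (T ^^ n) x)) \<longlonglongrightarrow> d k"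
    and "\<And>k. d k \<le> norm ((T ^^ k) x - x)"
proof -
  define g where "g = (\<lambda>k n. norm ((T ^^ (n + k)) x - (T ^^ n) x))"
  have "decseq (g k)" for k
    using T by (auto simp: decseq_Suc_iff g_def)
  then have "\<exists>L. g k \<longlonglongrightarrow> L \<and> (\<forall>n. L \<le> g k n)" for k
    by (rule decseq_convergent[of _ 0]) (auto simp: g_def)
  then obtain d where d: "\<And>k. g k \<longlonglongrightarrow> d k" "\<And>k n. d k \<le> g k n"
    by metis
  show thesis
  proof
    show "(\<lambda>n. norm ((T ^^ (n + k)) x - (T ^^ n) x)) \<longlonglongrightarrow> d k" for k
      using d(1) by (simp add: g_def)
    show "d k \<le> norm ((T ^^ k) x - x)" for k
      using d(2)[of k 0] by (simp add: g_def)
  qed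
qed

text \<open>
  The gaps of each fixed lag converge because \<open>T\<close> does not increase distances along the orbit. In the
  limit the midpoint inequality, applied to two orbit points at lag \<open>k + 1\<close>, compares this lag with
  the lags \<open>k\<close> and \<open>k + 2\<close>, which is convexity.
\<close>

lemma firmly_nonexpansive_asymptotically_regular:
  fixes T :: "'a::real_normed_vector \<Rightarrow> 'a"
  assumes firm: "firmly_nonexpansive T" and rate: "escape_rate T = 0"
  shows "(\<lambda>n. norm ((T ^^ Suc n) x - (T ^^ n) x)) \<longlonglongrightarrow> 0"
proof -
  note T = firmly_nonexpansive_imp_nonexpansive[OF firm]
  obtain d where lim: "\<And>k. (\<lambda>n. norm ((T ^^ (n + k)) x - (T ^^ n) x)) \<longlonglongrightarrow> d k"
    and le: "\<And>k. d k \<le> norm ((T ^^ k) x - x)"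
    using nonexpansive_gap_convergent[of T x] T by blast
  have "d 0 = 0"
    using lim[of 0] by (simp add: LIMSEQ_const_iff)
  have convex: "2 * d (Suc k) \<le> d (Suc (Suc k)) + d k" for k
  proof (rule LIMSEQ_le)
    show "(\<lambda>n. 2 * norm ((T ^^ (Suc n + Suc k)) x - (T ^^ Suc n) x)) \<longlonglongrightarrow> 2 * d (Suc k)"
      by (intro tendsto_mult tendsto_const LIMSEQ_Suc[OF lim])
    show "(\<lambda>n. norm ((T ^^ (n + Suc (Suc k))) x - (T ^^ n) x)
               + norm ((T ^^ (Suc n + k)) x - (T ^^ Suc n) x)) \<longlonglongrightarrow> d (Suc (Suc k)) + d k"
      by (intro tendsto_add lim LIMSEQ_Suc[OF lim])
    show "\<exists>N. \<forall>n\<ge>N. 2 * norm ((T ^^ (Suc n + Suc k)) x - (T ^^ Suc n) x)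
            \<le> norm ((T ^^ (n + Suc (Suc k))) x - (T ^^ n) x)
              + norm ((T ^^ (Suc n + k)) x - (T ^^ Suc n) x)"
      using firmly_nonexpansive_midpoint[OF firm] by simp
  qed
  have "d 1 \<le> 0"
  proof (rule LIMSEQ_le_const)
    have "(\<lambda>k. norm ((T ^^ k) x) / real k + norm x / real k) \<longlonglongrightarrow> 0 + 0"
      using tendsto_escape_rate[of T x] T rate by (intro tendsto_add lim_const_over_n) auto
    then show "(\<lambda>k. norm ((T ^^ k) x) / real k + norm x / real k) \<longlonglongrightarrow> 0"
      by simp
    have "d 1 \<le> norm ((T ^^ k) x) / real k + norm x / real k" if "k \<ge> 1" for k
    proof -
      have "real k * d 1 \<le> d k"
        by (rule convex_sequence_ge_linear[OF \<open>d 0 = 0\<close> convex])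
      also have "\<dots> \<le> norm ((T ^^ k) x) + norm x"
        using le[of k] norm_triangle_ineq4[of "(T ^^ k) x" x] by linarith
      finally show ?thesis
        using that by (simp add: field_simps)
    qed
    then show "\<exists>N. \<forall>k\<ge>N. d 1 \<le> norm ((T ^^ k) x) / real k + norm x / real k"
      by blast
  qed
  moreover have "0 \<le> d 1"
    by (rule LIMSEQ_le_const[OF lim[of 1]]) simp
  ultimately show ?thesis
    using lim[of 1] by simp
qed

section \<open>Cluster points in the space of metric functionals\<close>

text \<open>
  By the triangle inequality \<open>metric_embedding x y\<close> lies between \<open>- norm y\<close> and \<open>norm y\<close> whatever
  \<open>x\<close> is, so the closure sits inside a closed product of compact intervals and Tychonoff's theorem applies.
\<close>

lemma compact_metric_functionals:
  "compact (metric_functionals :: ('a::real_normed_vector \<Rightarrow> real) set)"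
proof -
  define B :: "('a \<Rightarrow> real) set" where "B = (\<Pi>\<^sub>E y\<in>UNIV. {- norm y..norm y})"
  have "compactin (product_topology (\<lambda>_. euclidean) UNIV) B"
    unfolding B_def by (auto simp: compactin_PiE)
  then have B: "compact B"
    by (simp add: euclidean_product_topology)
  have "closedin (product_topology (\<lambda>_. euclidean) UNIV) B"
    unfolding B_def by (auto simp: closedin_product_topology)
  then have "closed B"
    by (simp add: euclidean_product_topology)
  have "metric_embedding x \<in> B" for x
  proof -
    have "norm (y - x) \<le> norm y + norm x" "norm x \<le> norm y + norm (y - x)" for y
      using norm_triangle_ineq4[of y x] norm_triangle_ineq4[of y "y - x"] by simp_all
    then have "- norm y \<le> norm (y - x) - norm x" "norm (y - x) - norm x \<le> norm y" for y
      by (smt (verit))+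
    then show ?thesis
      by (auto simp: B_def metric_embedding_def PiE_iff)
  qed
  then have "metric_functionals \<subseteq> closure B"
    unfolding metric_functionals_def by (intro closure_mono) auto
  then have "metric_functionals \<subseteq> B"
    using \<open>closed B\<close> by (simp add: closure_closed)
  then have "metric_functionals = B \<inter> metric_functionals"
    by blast
  also have "compact \<dots>"
    using B by (intro compact_Int_closed) (auto simp: metric_functionals_def)
  finally show ?thesis .
qed

text \<open>
  The function space need not be metrizable, so the point is found as a cluster point of the filter
  generated by the tails of the sequence, not as the limit of a subsequence.
\<close>

lemma compact_imp_sequence_limit_point:
  fixes u :: "nat \<Rightarrow> 'b::topological_space"
  assumes "compact K" and "\<And>n. u n \<in> K"
  shows "\<exists>l\<in>K. sequence_limit_point (top_of_set K) u l"
proof -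
  have "\<exists>l\<in>K. inf (nhds l) (filtermap u sequentially) \<noteq> bot"
    using assms unfolding compact_filter
    by (elim allE[of _ "filtermap u sequentially"])
       (auto simp: filtermap_bot_iff eventually_filtermap)
  then obtain l where "l \<in> K" and l: "inf (nhds l) (filtermap u sequentially) \<noteq> bot"
    by blast
  have "infinite {n. u n \<in> U}" if "openin (top_of_set K) U" "l \<in> U" for U
  proof
    assume "finite {n. u n \<in> U}"
    then have "eventually (\<lambda>n. u n \<notin> U) sequentially"
      by (simp add: eventually_cofinite flip: cofinite_eq_sequentially)
    moreover obtain W where W: "open W" "U = K \<inter> W"
      using \<open>openin (top_of_set K) U\<close> by (auto simp: openin_open)
    ultimately have "eventually (\<lambda>y. y \<notin> W) (filtermap u sequentially)"
      using assms(2) by (simp add: eventually_filtermap)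
    moreover have "eventually (\<lambda>y. y \<in> W) (nhds l)"
      using W \<open>l \<in> U\<close> by (intro eventually_nhds_in_open) auto
    ultimately have "eventually (\<lambda>_. False) (inf (nhds l) (filtermap u sequentially))"
      unfolding eventually_inf by blast
    then show False
      using l by (simp add: trivial_limit_def)
  qed
  then show ?thesis
    using \<open>l \<in> K\<close> by (auto simp: sequence_limit_point_def)
qed

lemma sequence_limit_point_evaluation_le:
  fixes u :: "nat \<Rightarrow> 'a \<Rightarrow> real"
  assumes h: "sequence_limit_point (top_of_set K) u h"
    and ineq: "\<And>n. u n a \<le> u n b + \<epsilon> n" and "\<epsilon> \<longlonglongrightarrow> 0"
  shows "h a \<le> h b"
proof (rule ccontr)
  assume "\<not> h a \<le> h b"
  define e where "e = (h a - h b) / 2"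
  have "e > 0"
    using \<open>\<not> h a \<le> h b\<close> by (simp add: e_def)
  define W where "W = {f :: 'a \<Rightarrow> real. e < f a - f b}"
  have "open W"
    unfolding W_def
    by (intro open_Collect_less continuous_intros continuous_on_product_coordinates)
  moreover have "h \<in> W" "h \<in> K"
    using \<open>e > 0\<close> h by (simp_all add: W_def e_def sequence_limit_point_def)
  ultimately have "infinite {n. u n \<in> K \<inter> W}"
    using h by (auto simp: sequence_limit_point_def openin_open_Int)
  moreover have "eventually (\<lambda>n. \<epsilon> n < e) sequentially"
    using \<open>\<epsilon> \<longlonglongrightarrow> 0\<close> \<open>e > 0\<close> by (rule order_tendstoD)
  then have "eventually (\<lambda>n. u n \<notin> K \<inter> W) sequentially"
  proof eventually_elim
    case (elim n)
    then show ?case using ineq[of n] by (auto simp: W_def)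
  qed
  then have "finite {n. u n \<in> K \<inter> W}"
    by (simp add: eventually_cofinite flip: cofinite_eq_sequentially)
  ultimately show False
    by blast
qed

lemma metric_embedding_image_le:
  fixes T :: "'a::real_normed_vector \<Rightarrow> 'a"
  assumes "\<And>x y. norm (T x - T y) \<le> norm (x - y)"
  shows "metric_embedding z (T x) \<le> metric_embedding z x + norm (T z - z)"
proof -
  have "norm (T x - z) \<le> norm (T x - T z) + norm (T z - z)"
    using norm_triangle_ineq[of "T x - T z" "T z - z"] by simp
  then show ?thesis
    using assms[of x z] by (simp add: metric_embedding_def)
qed

text \<open>
  Every cluster point of the orbit has the required property, since the error terms in
  \<open>metric_embedding_image_le\<close> at the orbit points are the step lengths, which tend to zero.
\<close>

theorem proposition2p3:
  fixes T :: "'a::banach \<Rightarrow> 'a"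
  assumes "firmly_nonexpansive T"
    and "escape_rate T = 0"
  shows "\<exists>h\<in>metric_functionals.
           sequence_limit_point (top_of_set metric_functionals)
             (\<lambda>n. metric_embedding ((T ^^ n) 0)) h \<and>
           (\<forall>x. h (T x) \<le> h x)"
proof -
  note T = firmly_nonexpansive_imp_nonexpansive[OF assms(1)]
  have "metric_embedding z \<in> metric_functionals" for z :: 'a
    unfolding metric_functionals_def by (rule subsetD[OF closure_subset]) simp
  then obtain h where "h \<in> metric_functionals"
    and h: "sequence_limit_point (top_of_set metric_functionals)
              (\<lambda>n. metric_embedding ((T ^^ n) 0)) h"
    using compact_imp_sequence_limit_point[OF compact_metric_functionals,
        of "\<lambda>n. metric_embedding ((T ^^ n) 0)"] by blast
  have "h (T x) \<le> h x" for x
  proof (rule sequence_limit_point_evaluation_le[OF h])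
    show "metric_embedding ((T ^^ n) 0) (T x)
            \<le> metric_embedding ((T ^^ n) 0) x + norm ((T ^^ Suc n) 0 - (T ^^ n) 0)" for n
      using metric_embedding_image_le[OF T, of "(T ^^ n) 0" x] by simp
    show "(\<lambda>n. norm ((T ^^ Suc n) 0 - (T ^^ n) 0)) \<longlonglongrightarrow> 0"
      by (rule firmly_nonexpansive_asymptotically_regular[OF assms])
  qed
  with \<open>h \<in> metric_functionals\<close> h show ?thesis
    by blast
qed

end
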